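(* Let $S$ be a weak system of quotients of a Lie triple system $T$ over a field $\mathbf{F}$. (1) If $I$ is a nonzero ideal of $S$, then $I\cap T$ is a nonzero ideal of $T$. (2) If $T$ is semiprime, then $S$ is semiprime; and if $T$ is prime, then $S$ is prime.
   Context: $\mathbf{F}$ is a field of arbitrary characteristic. A Lie triple system (LTS) over $\mathbf{F}$ is a vector space $T$ with a trilinear map $(x,y,z)\mapsto[x,y,z]$ such that $[x,x,z]=0$, $[x,y,z]+[y,z,x]+[z,x,y]=0$, and $[u,v,[x,y,z]]=[[u,v,x],y,z]+[x,[u,v,y],z]+[x,y,[u,v,z]]$ for all $x,y,z,u,v\in T$. A subsystem of $T$ is a subspace $I$ with $[I,I,I]\subseteq I$; an ideal of $T$ is a subspace $I$ with $[I,T,T]\subseteq I$. Brackets of subspaces denote the linear span of the corresponding brackets of elements. $T$ is semiprime if $[T,I,I]\neq0$ for every nonzero ideal $I$ of $T$; $T$ is prime if $[T,I,J]\neq0$ for all nonzero ideals $I,J$ of $T$. Let $T$ be a subsystem of an LTS $S$. $S$ is a weak system of quotients of $T$ if for every $0\neq s\in S$ there exist $x,y\in T$ such that $0\neq[s,x,y]\in T$. *)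

theory Defs
  imports Main "HOL.Vector_Spaces"
begin

locale lie_triple_system = vector_space scale
  for scale :: "'k::field \<Rightarrow> 'v::ab_group_add \<Rightarrow> 'v" +
  fixes br :: "'v \<Rightarrow> 'v \<Rightarrow> 'v \<Rightarrow> 'v"
  assumes linear_fst: "Vector_Spaces.linear scale scale (\<lambda>x. br x y z)"
    and linear_snd: "Vector_Spaces.linear scale scale (\<lambda>y. br x y z)"
    and linear_trd: "Vector_Spaces.linear scale scale (\<lambda>z. br x y z)"
    and alternating: "br x x z = 0"
    and cyclic: "br x y z + br y z x + br z x y = 0"
    and derivation:
      "br u v (br x y z) = br (br u v x) y z + br x (br u v y) z + br x y (br u v z)"
begin

definition bracket_span :: "'v set \<Rightarrow> 'v set \<Rightarrow> 'v set \<Rightarrow> 'v set" where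
  "bracket_span A B C = span {br a b c |a b c. a \<in> A \<and> b \<in> B \<and> c \<in> C}"

definition subsystem :: "'v set \<Rightarrow> bool" where
  "subsystem T \<longleftrightarrow> subspace T \<and> bracket_span T T T \<subseteq> T"

text \<open>The following three notions take a subsystem \<open>T\<close> and regard it as a Lie triple system
  in its own right, with the restricted bracket; for the ambient system take \<open>T = UNIV\<close>.\<close>

definition ideal :: "'v set \<Rightarrow> 'v set \<Rightarrow> bool" where
  "ideal T I \<longleftrightarrow> subspace I \<and> I \<subseteq> T \<and> bracket_span I T T \<subseteq> I"

definition semiprime :: "'v set \<Rightarrow> bool" where
  "semiprime T \<longleftrightarrow> (\<forall>I. ideal T I \<and> I \<noteq> {0} \<longrightarrow> bracket_span T I I \<noteq> {0})"

definition prime :: "'v set \<Rightarrow> bool" where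
  "prime T \<longleftrightarrow>
    (\<forall>I J. ideal T I \<and> I \<noteq> {0} \<and> ideal T J \<and> J \<noteq> {0} \<longrightarrow> bracket_span T I J \<noteq> {0})"

text \<open>The ambient system (the whole type) is a weak system of quotients of \<open>T\<close>.\<close>

definition weak_system_of_quotients_of :: "'v set \<Rightarrow> bool" where
  "weak_system_of_quotients_of T \<longleftrightarrow>
    subsystem T \<and> (\<forall>s. s \<noteq> 0 \<longrightarrow> (\<exists>x\<in>T. \<exists>y\<in>T. br s x y \<noteq> 0 \<and> br s x y \<in> T))"

end

end

theory Submission imports Defs begin

context lie_triple_system
begin

text \<open>Everything passes through the trace \<open>I \<inter> T\<close> of an ideal
  \<open>I\<close> of the ambient system. The quotient condition multiplies a nonzero element of
  \<open>I\<close> by two elements of \<open>T\<close> into a nonzero element of \<open>T\<close>;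
  since \<open>I\<close> is an ideal the product also stays in \<open>I\<close>, so the trace is
  nonzero (\<open>ideal_Int_nonzero\<close>). It is an ideal of \<open>T\<close> by
  \<open>ideal_Int_subsystem\<close>. Hence (semi)primeness of \<open>T\<close> makes the bracket of
  traces nonzero, and this bracket lies inside that of the original ideals.\<close>

lemma bracket_span_mono:
  "A \<subseteq> A' \<Longrightarrow> B \<subseteq> B' \<Longrightarrow> C \<subseteq> C' \<Longrightarrow> bracket_span A B C \<subseteq> bracket_span A' B' C'"
  unfolding bracket_span_def by (rule span_mono) blast

lemma br_in_bracket_span:
  "a \<in> A \<Longrightarrow> b \<in> B \<Longrightarrow> c \<in> C \<Longrightarrow> br a b c \<in> bracket_span A B C"
  unfolding bracket_span_def by (rule span_base) blast

text \<open>A span contains 0, so differing from \<open>{0}\<close> means having a nonzero element,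
  and such an element survives enlarging the factors. This carries non-vanishing from
  \<open>T\<close> up to the ambient system.\<close>

lemma bracket_span_nonzero_mono:
  assumes "bracket_span A B C \<noteq> {0}" "A \<subseteq> A'" "B \<subseteq> B'" "C \<subseteq> C'"
  shows "bracket_span A' B' C' \<noteq> {0}"
proof -
  have "0 \<in> bracket_span A B C"
    unfolding bracket_span_def by (rule span_zero)
  then show ?thesis
    using assms(1) bracket_span_mono[OF assms(2-4)] by blast
qed

lemma ideal_Int_subsystem:
  assumes "ideal UNIV I" "subsystem T"
  shows "ideal T (I \<inter> T)"
proof -
  \<comment> \<open>The first bound lands in \<open>I\<close> because \<open>I\<close> is an ideal,
    the second in \<open>T\<close> because \<open>T\<close> is closed under the bracket.\<close>
  have "bracket_span (I \<inter> T) T T \<subseteq> bracket_span I UNIV UNIV"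
    "bracket_span (I \<inter> T) T T \<subseteq> bracket_span T T T"
    by (simp_all add: bracket_span_mono)
  then show ?thesis
    using assms unfolding ideal_def subsystem_def by (blast intro: subspace_inter)
qed

lemma ideal_Int_nonzero:
  assumes T: "weak_system_of_quotients_of T" and I: "ideal UNIV I" "I \<noteq> {0}"
  shows "I \<inter> T \<noteq> {0}"
proof -
  \<comment> \<open>This excludes the empty set, so that \<open>I \<noteq> {0}\<close> really yields
    a nonzero element.\<close>
  have "0 \<in> I"
    using I(1) unfolding ideal_def by (blast intro: subspace_0)
  then obtain s where s: "s \<in> I" "s \<noteq> 0"
    using I(2) by blast
  then obtain x y where "br s x y \<noteq> 0" "br s x y \<in> T"
    using T unfolding weak_system_of_quotients_of_def by blast
  moreover have "br s x y \<in> I"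
    using I(1) br_in_bracket_span[OF s(1) UNIV_I UNIV_I] unfolding ideal_def by blast
  ultimately show ?thesis by blast
qed

lemma semiprime_weak_system_of_quotients:
  assumes "weak_system_of_quotients_of T" "semiprime T"
  shows "semiprime UNIV"
  unfolding semiprime_def
proof (intro allI impI)
  fix I assume "ideal UNIV I \<and> I \<noteq> {0}"
  then have "bracket_span T (I \<inter> T) (I \<inter> T) \<noteq> {0}"
    using assms ideal_Int_subsystem ideal_Int_nonzero
    unfolding semiprime_def by (metis weak_system_of_quotients_of_def)
  then show "bracket_span UNIV I I \<noteq> {0}"
    by (rule bracket_span_nonzero_mono) auto
qed

lemma prime_weak_system_of_quotients:
  assumes "weak_system_of_quotients_of T" "prime T"
  shows "prime UNIV"
  unfolding prime_def
proof (intro allI impI)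
  fix I J assume "ideal UNIV I \<and> I \<noteq> {0} \<and> ideal UNIV J \<and> J \<noteq> {0}"
  \<comment> \<open>Primeness of \<open>T\<close> applies to the two traces, each a nonzero ideal of
    \<open>T\<close>.\<close>
  then have "bracket_span T (I \<inter> T) (J \<inter> T) \<noteq> {0}"
    using assms ideal_Int_subsystem ideal_Int_nonzero
    unfolding prime_def by (metis weak_system_of_quotients_of_def)
  then show "bracket_span UNIV I J \<noteq> {0}"
    by (rule bracket_span_nonzero_mono) auto
qed

end

theorem mainTheorem5:
  fixes scale :: "'k::field \<Rightarrow> 'v::ab_group_add \<Rightarrow> 'v"
    and br :: "'v \<Rightarrow> 'v \<Rightarrow> 'v \<Rightarrow> 'v"
    and T :: "'v set"
  assumes "lie_triple_system scale br"
    and "lie_triple_system.weak_system_of_quotients_of scale br T"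
  shows "(\<forall>I. lie_triple_system.ideal scale br UNIV I \<and> I \<noteq> {0} \<longrightarrow>
            lie_triple_system.ideal scale br T (I \<inter> T) \<and> I \<inter> T \<noteq> {0})
      \<and> (lie_triple_system.semiprime scale br T \<longrightarrow> lie_triple_system.semiprime scale br UNIV)
      \<and> (lie_triple_system.prime scale br T \<longrightarrow> lie_triple_system.prime scale br UNIV)"
proof -
  interpret lie_triple_system scale br by fact
  have "subsystem T"
    using assms(2) unfolding weak_system_of_quotients_of_def by blast
  then show ?thesis
    using assms(2) ideal_Int_subsystem ideal_Int_nonzero
      semiprime_weak_system_of_quotients prime_weak_system_of_quotients by blast
qed

end
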